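(* Suppose that the family $\mathcal{X}/\mathcal{S}$ of smooth projective hypersurfaces defined by the polynomial $P \in \mathbf{Z}_q[t][x_0,\dotsc,x_n]$, homogeneous of degree $d$ in $x_0,\dotsc,x_n$, contains a diagonal fibre. For $k \in \mathbf{N}$ and $0 \le j \le n$ let $U_k^{(j)}$ be the $\mathbf{Q}_q(t)$-vector space of polynomials with basis $C_k^{(j)}$, and let $U_k = U_k^{(0)} \times \dotsb \times U_k^{(n)}$. Let $V_k$ and $W_k$ be the $\mathbf{Q}_q(t)$-vector spaces of polynomials with bases $F_k$ and $R_k$, respectively, and let $\pi \colon V_k \to W_k$ be the linear map that sends the elements of $B_k$ to zero and the elements of $R_k$ to themselves. Then the map $$\phi_k \colon U_k \to W_k, \qquad (Q_0,\dotsc,Q_n) \mapsto \pi\bigl(Q_0\,\partial_0 P + \dotsb + Q_n\,\partial_n P\bigr)$$ is an isomorphism of $\mathbf{Q}_q(t)$-vector spaces.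
   Context: $p$ is a prime, $q$ a power of $p$, $\mathbf{Q}_q$ the unramified extension of $\mathbf{Q}_p$ with residue field $\mathbf{F}_q$, and $\mathbf{Z}_q$ its ring of integers. $\mathbf{N}=\{1,2,\dots\}$ and $\mathbf{N}_0=\{0,1,2,\dots\}$. $\mathcal{S}\subset \mathbf{P}^1_{\mathbf{Z}_q}$ (with coordinate $t$) is a Zariski open subset such that $P$ defines a smooth family $\mathcal{X}/\mathcal{S}$ of hypersurfaces in $\mathbf{P}^n_{\mathcal{S}}$. The family contains a diagonal fibre if there is $t_0\in\mathcal{S}(\mathbf{Z}_q)$ such that $\mathcal{X}_{t_0}$ is defined by $P_{t_0}=a_0x_0^d+\dotsb+a_nx_n^d$ with $a_0,\dotsc,a_n\in\mathbf{Z}_q^\times$. $\partial_j$ is the partial derivative with respect to $x_j$. For $u=(u_0,\dotsc,u_n)\in\mathbf{N}_0^{n+1}$ write $x^u=x_0^{u_0}\dotsm x_n^{u_n}$, $|u|=\sum u_i$. For $k\in\mathbf{N}$: $F_k=\{x^u : |u|=kd-(n+1)\}$; $B_k=\{x^u\in F_k : u_i<d-1 \text{ for all } i\}$; $R_k=F_k\setminus B_k$. $C_k^{(0)}$ is the set of monomials in $x_0,\dotsc,x_n$ of total degree $(k-1)d-n$, and inductively, for $1\le j\le n$, $C_k^{(j)}$ is the set of monomials in $C_k^{(j-1)}$ that are not divisible by $x_{j-1}^{d-1}$. *)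

theory Defs
  imports
    "HOL-Library.Poly_Mapping"
    "HOL-Library.Function_Algebras"
    "HOL-Computational_Algebra.Computational_Algebra"
    "HOL-Algebra.QuotRing"
begin

section \<open>Polynomials in several variables\<close>

text \<open>
  A polynomial with coefficients in \<^typ>\<open>'a\<close> and variables indexed by \<^typ>\<open>'v\<close> is an element
  of \<^typ>\<open>('v \<Rightarrow>\<^sub>0 nat) \<Rightarrow>\<^sub>0 'a\<close>; a monomial is identified with its exponent vector.
\<close>

abbreviation (input) keys :: "('a \<Rightarrow>\<^sub>0 'b::zero) \<Rightarrow> 'a set" where
  "keys \<equiv> Poly_Mapping.keys"

abbreviation (input) lookup :: "('a \<Rightarrow>\<^sub>0 'b::zero) \<Rightarrow> 'a \<Rightarrow> 'b" where
  "lookup \<equiv> Poly_Mapping.lookup"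

type_synonym ('v, 'a) mpoly = "('v \<Rightarrow>\<^sub>0 nat) \<Rightarrow>\<^sub>0 'a"

text \<open>The subring $A[V]$ of polynomials with coefficients in $A$ involving only variables in $V$.\<close>

definition mpolys :: "'a::zero set \<Rightarrow> 'v set \<Rightarrow> ('v, 'a) mpoly set" where
  "mpolys A V = {F. (\<forall>m. lookup F m \<in> A) \<and> (\<forall>m\<in>keys F. keys m \<subseteq> V)}"

definition upolys :: "'a::zero set \<Rightarrow> 'a poly set" where
  "upolys A = {f. \<forall>i. poly.coeff f i \<in> A}"

definition var :: "'v \<Rightarrow> ('v, 'a::zero_neq_one) mpoly" where
  "var v = Poly_Mapping.single (Poly_Mapping.single v 1) 1"

text \<open>The degree of a monomial with respect to a finite set of variables.\<close>

definition mdeg :: "'v set \<Rightarrow> ('v \<Rightarrow>\<^sub>0 nat) \<Rightarrow> nat" where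
  "mdeg V m = (\<Sum>v\<in>V. lookup m v)"

text \<open>
  The linear map that fixes the monomials in \<open>M\<close> and sends all other monomials to zero.
\<close>

definition proj :: "('v \<Rightarrow>\<^sub>0 nat) set \<Rightarrow> ('v, 'a) mpoly \<Rightarrow> ('v, 'a::comm_monoid_add) mpoly" where
  "proj M F = (\<Sum>m\<in>keys F \<inter> M. Poly_Mapping.single m (lookup F m))"

definition mpoly_eval :: "('v \<Rightarrow> 'a) \<Rightarrow> ('v, 'a) mpoly \<Rightarrow> 'a::comm_semiring_1" where
  "mpoly_eval \<alpha> F = (\<Sum>m\<in>keys F. lookup F m * (\<Prod>v\<in>keys m. \<alpha> v ^ lookup m v))"

definition pderiv_mpoly :: "'v \<Rightarrow> ('v, 'a) mpoly \<Rightarrow> ('v, 'a::comm_semiring_1) mpoly" where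
  "pderiv_mpoly v F =
     (\<Sum>m\<in>keys F. Poly_Mapping.single (m - Poly_Mapping.single v 1)
       (of_nat (lookup m v) * lookup F m))"

definition homogeneous_of_degree :: "'v set \<Rightarrow> nat \<Rightarrow> ('v, 'a::zero) mpoly \<Rightarrow> bool" where
  "homogeneous_of_degree V d F \<longleftrightarrow> (\<forall>m\<in>keys F. mdeg V m = d)"

text \<open>
  A set closed under taking homogeneous components with respect to the grading by the degree
  in \<open>V\<close>; for an ideal this says that the ideal is homogeneous.
\<close>

definition homogeneous_set :: "'v set \<Rightarrow> ('v, 'a::comm_monoid_add) mpoly set \<Rightarrow> bool" where
  "homogeneous_set V I \<longleftrightarrow> (\<forall>F\<in>I. \<forall>e. proj {m. mdeg V m = e} F \<in> I)"

definition mscale :: "'a \<Rightarrow> ('v, 'a) mpoly \<Rightarrow> ('v, 'a::comm_ring_1) mpoly" where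
  "mscale c F = Poly_Mapping.map ((*) c) F"

definition tscale :: "'a \<Rightarrow> (nat \<Rightarrow> ('v, 'a) mpoly) \<Rightarrow> nat \<Rightarrow> ('v, 'a::comm_ring_1) mpoly" where
  "tscale c Q = (\<lambda>j. mscale c (Q j))"

interpretation mpoly: vector_space "mscale :: 'a::field \<Rightarrow> ('v, 'a) mpoly \<Rightarrow> ('v, 'a) mpoly"
  by unfold_locales
    (simp_all add: mscale_def mult_map_scale_conv_mult algebra_simps single_add
      mult.assoc[symmetric] mult_single)


section \<open>Unramified extensions of the $p$-adic numbers\<close>

text \<open>A commutative ring record (with the operations of the type) on a subset of a type.\<close>

definition ring_on :: "'a::comm_ring_1 set \<Rightarrow> 'a ring" where
  "ring_on A = \<lparr>carrier = A, monoid.mult = (*), one = 1, ring.zero = 0, add = (+)\<rparr>"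

definition padic_abs :: "nat \<Rightarrow> rat \<Rightarrow> real" where
  "padic_abs p x = (if x = 0 then 0 else
     (let (a, b) = quotient_of x in
       real p powi (int (multiplicity (int p) b) - int (multiplicity (int p) a))))"

text \<open>The closure of the prime field with respect to an absolute value.\<close>

definition rat_closure :: "('k::field_char_0 \<Rightarrow> real) \<Rightarrow> 'k set" where
  "rat_closure nrm = {x. \<exists>r::nat \<Rightarrow> rat. (\<lambda>i. nrm (x - of_rat (r i))) \<longlonglongrightarrow> 0}"

definition integer_ring :: "('k::field \<Rightarrow> real) \<Rightarrow> 'k set" where
  "integer_ring nrm = {x. nrm x \<le> 1}"

definition maximal_ideal :: "('k::field \<Rightarrow> real) \<Rightarrow> 'k set" where
  "maximal_ideal nrm = {x. nrm x < 1}"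

text \<open>
  The whole type \<^typ>\<open>'k\<close>, with absolute value \<open>nrm\<close>, is the unramified extension
  $\mathbf{Q}_q$ of $\mathbf{Q}_p$ with residue field $\mathbf{F}_q$. The subfield
  $\mathbf{Q}_p$ is \<^term>\<open>rat_closure nrm\<close>: by \<open>nrm_rat\<close> and \<open>Qp_complete\<close> it is the
  completion of $\mathbf{Q}$ with respect to the $p$-adic absolute value.
  These properties determine the field up to isomorphism.
\<close>

locale unramified_extension =
  fixes p q :: nat and nrm :: "'k::field_char_0 \<Rightarrow> real"
  assumes prime_p: "prime p"
    and q_power: "\<exists>f\<ge>1. q = p ^ f"
    and nrm_nonneg: "nrm x \<ge> 0"
    and nrm_eq_0: "nrm x = 0 \<longleftrightarrow> x = 0"
    and nrm_mult: "nrm (x * y) = nrm x * nrm y"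
    and nrm_ultrametric: "nrm (x + y) \<le> max (nrm x) (nrm y)"
    and nrm_rat: "nrm (of_rat r) = padic_abs p r"
    and Qp_complete: "(\<forall>\<epsilon>>0. \<exists>N. \<forall>i\<ge>N. \<forall>j\<ge>N. padic_abs p (s i - s j) < \<epsilon>)
          \<Longrightarrow> \<exists>x. (\<lambda>i::nat. nrm (x - of_rat (s i))) \<longlonglongrightarrow> 0"
    and finite_extension: "\<exists>B. finite B \<and>
          (\<forall>x. \<exists>c. (\<forall>b\<in>B. c b \<in> rat_closure nrm) \<and> x = (\<Sum>b\<in>B. c b * b))"
    and unramified: "nrm ` (UNIV - {0}) = nrm ` (rat_closure nrm - {0})"
    and residue_field: "card (carrier (ring_on (integer_ring nrm) Quot maximal_ideal nrm)) = q"


section \<open>Families of projective hypersurfaces over open subsets of the projective line\<close>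

text \<open>
  \<open>T0\<close>, \<open>T1\<close> are homogeneous coordinates on the projective line, with affine coordinate
  $t = T_0/T_1$; \<open>X 0, \<dots>, X n\<close> are the homogeneous coordinates on $\mathbf{P}^n$.
\<close>

datatype coord = T0 | T1 | X nat

abbreviation Tvars :: "coord set" where "Tvars \<equiv> {T0, T1}"
abbreviation Xvars :: "nat \<Rightarrow> coord set" where "Xvars n \<equiv> X ` {..n}"

text \<open>The points of $\mathbf{P}^1_A = \mathrm{Proj}\,A[T_0,T_1]$.\<close>

definition P1_points :: "'a::comm_ring_1 set \<Rightarrow> (coord, 'a) mpoly set set" where
  "P1_points A = {I. primeideal I (ring_on (mpolys A Tvars)) \<and> homogeneous_set Tvars I
                     \<and> \<not> var ` Tvars \<subseteq> I}"

definition P1_open :: "'a::comm_ring_1 set \<Rightarrow> (coord, 'a) mpoly set set \<Rightarrow> bool" where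
  "P1_open A S \<longleftrightarrow> (\<exists>G \<subseteq> mpolys A Tvars.
      (\<forall>F\<in>G. \<exists>e. homogeneous_of_degree Tvars e F) \<and> S = {I \<in> P1_points A. \<not> G \<subseteq> I})"

text \<open>
  The points of $\mathbf{P}^n_S$: bihomogeneous prime ideals of $A[T_0,T_1][X_0,\dots,X_n]$ that do
  not contain either irrelevant ideal, and whose image in $\mathbf{P}^1_A$ lies in $S$.
\<close>

definition Pn_points ::
  "'a::comm_ring_1 set \<Rightarrow> nat \<Rightarrow> (coord, 'a) mpoly set set \<Rightarrow> (coord, 'a) mpoly set set" where
  "Pn_points A n S = {I. primeideal I (ring_on (mpolys A (Tvars \<union> Xvars n)))
      \<and> homogeneous_set Tvars I \<and> homogeneous_set (Xvars n) I
      \<and> \<not> var ` Tvars \<subseteq> I \<and> \<not> var ` Xvars n \<subseteq> I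
      \<and> I \<inter> mpolys A Tvars \<in> S}"

text \<open>The degree in $t$ of a polynomial in $A[t][x_0,\dots,x_n]$.\<close>

definition tdegree :: "(nat, 'a::zero poly) mpoly \<Rightarrow> nat" where
  "tdegree P = Max (insert 0 ((\<lambda>m. Polynomial.degree (lookup P m)) ` keys P))"

text \<open>
  To make sense of the family near $t = \infty$, \<open>P\<close> is homogenised with respect to \<open>t\<close>:
  $T_1^e\,P(T_0/T_1, X_0, \dots, X_n)$ with $e = \deg_t P$.
\<close>

definition homogenise_t :: "(nat, 'a::comm_ring_1 poly) mpoly \<Rightarrow> (coord, 'a) mpoly" where
  "homogenise_t P = (\<Sum>m\<in>keys P. \<Sum>i\<le>tdegree P.
     Poly_Mapping.single
       (Poly_Mapping.single T0 i + Poly_Mapping.single T1 (tdegree P - i)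
         + (\<Sum>j\<in>keys m. Poly_Mapping.single (X j) (lookup m j)))
       (poly.coeff (lookup P m) i))"

text \<open>
  The Jacobian criterion at each scheme point of the family. If the equation vanished identically
  on the fibre over some point of $S$, then so would its partial derivatives; hence every fibre is
  a hypersurface.
\<close>

definition smooth_family ::
  "'a::comm_ring_1 set \<Rightarrow> nat \<Rightarrow> (nat, 'a poly) mpoly \<Rightarrow> (coord, 'a) mpoly set set \<Rightarrow> bool" where
  "smooth_family A n P S \<longleftrightarrow> (\<forall>I \<in> Pn_points A n S. homogenise_t P \<in> I \<longrightarrow>
      (\<exists>j\<le>n. pderiv_mpoly (X j) (homogenise_t P) \<notin> I))"

definition is_unit_in :: "'a::comm_ring_1 set \<Rightarrow> 'a \<Rightarrow> bool" where
  "is_unit_in A x \<longleftrightarrow> x \<in> Units (ring_on A)"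

text \<open>
  For local \<open>A\<close>, every element of $\mathbf{P}^1(A)$ has the form $(a:b)$ with $a, b \in A$, one of
  them a unit. It is an \<open>A\<close>-valued point of $S$ if the corresponding section of
  $\mathbf{P}^1_A \to \mathrm{Spec}\,A$ sends each prime ideal of \<open>A\<close> into $S$.
\<close>

definition section_of :: "'a::comm_ring_1 set \<Rightarrow> 'a \<Rightarrow> 'a \<Rightarrow> 'a set \<Rightarrow> (coord, 'a) mpoly set" where
  "section_of A a b \<pp> = {F \<in> mpolys A Tvars.
     \<forall>e. mpoly_eval (case_coord a b (\<lambda>_. 0)) (proj {m. mdeg Tvars m = e} F) \<in> \<pp>}"

definition valued_point ::
  "'a::comm_ring_1 set \<Rightarrow> (coord, 'a) mpoly set set \<Rightarrow> 'a \<Rightarrow> 'a \<Rightarrow> bool" where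
  "valued_point A S a b \<longleftrightarrow> a \<in> A \<and> b \<in> A \<and> (is_unit_in A a \<or> is_unit_in A b)
     \<and> (\<forall>\<pp>. primeideal \<pp> (ring_on A) \<longrightarrow> section_of A a b \<pp> \<in> S)"

text \<open>
  The equation of the fibre at $(a:b)$, well defined up to a unit; for $b = 1$ it is $P$
  evaluated at $t = a$.
\<close>

definition fibre_eq :: "(nat, 'a::comm_ring_1 poly) mpoly \<Rightarrow> 'a \<Rightarrow> 'a \<Rightarrow> (nat, 'a) mpoly" where
  "fibre_eq P a b = (\<Sum>m\<in>keys P. Poly_Mapping.single m
     (\<Sum>i\<le>tdegree P. poly.coeff (lookup P m) i * a ^ i * b ^ (tdegree P - i)))"

lemma lookup_fibre_eq_affine: "lookup (fibre_eq P a 1) m = poly (lookup P m) a"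
proof -
  have *: "(\<Sum>i\<le>tdegree P. poly.coeff (lookup P m) i * a ^ i) = poly (lookup P m) a"
    if "m \<in> keys P" for m
  proof -
    have "Polynomial.degree (lookup P m) \<le> tdegree P"
      unfolding tdegree_def using that by (intro Max_ge) auto
    then have "poly (lookup P m) a = (\<Sum>i\<le>tdegree P. poly.coeff (lookup P m) i * a ^ i)"
      unfolding poly_altdef by (intro sum.mono_neutral_left) (auto simp: coeff_eq_0)
    then show ?thesis ..
  qed
  have "lookup (fibre_eq P a 1) m
      = (\<Sum>m'\<in>keys P. if m' = m then poly (lookup P m') a else 0)"
    unfolding fibre_eq_def using *
    by (simp add: lookup_sum lookup_single when_def cong: sum.cong if_cong)
  also have "\<dots> = poly (lookup P m) a"
    by (cases "m \<in> keys P") (auto simp: in_keys_iff)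
  finally show ?thesis .
qed

definition contains_diagonal_fibre ::
  "'a::comm_ring_1 set \<Rightarrow> nat \<Rightarrow> nat \<Rightarrow> (nat, 'a poly) mpoly \<Rightarrow> (coord, 'a) mpoly set set \<Rightarrow> bool"
where
  "contains_diagonal_fibre A n d P S \<longleftrightarrow> (\<exists>a b. valued_point A S a b \<and>
     (\<exists>\<alpha>. (\<forall>i\<le>n. is_unit_in A (\<alpha> i)) \<and>
        fibre_eq P a b = (\<Sum>i\<le>n. mscale (\<alpha> i) (var i ^ d))))"


section \<open>The monomial bases and the map\<close>

definition F_set :: "nat \<Rightarrow> nat \<Rightarrow> nat \<Rightarrow> (nat \<Rightarrow>\<^sub>0 nat) set" where
  "F_set n d k = {u. keys u \<subseteq> {..n} \<and> int (mdeg {..n} u) = int k * int d - (int n + 1)}"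

definition B_set :: "nat \<Rightarrow> nat \<Rightarrow> nat \<Rightarrow> (nat \<Rightarrow>\<^sub>0 nat) set" where
  "B_set n d k = {u \<in> F_set n d k. \<forall>i\<le>n. lookup u i < d - 1}"

definition R_set :: "nat \<Rightarrow> nat \<Rightarrow> nat \<Rightarrow> (nat \<Rightarrow>\<^sub>0 nat) set" where
  "R_set n d k = F_set n d k - B_set n d k"

fun C_set :: "nat \<Rightarrow> nat \<Rightarrow> nat \<Rightarrow> nat \<Rightarrow> (nat \<Rightarrow>\<^sub>0 nat) set" where
  "C_set n d k 0 = {u. keys u \<subseteq> {..n} \<and> int (mdeg {..n} u) = (int k - 1) * int d - int n}"
| "C_set n d k (Suc j) = {u \<in> C_set n d k j. \<not> d - 1 \<le> lookup u j}"

text \<open>The vector space of polynomials with the monomials in \<open>M\<close> as a basis.\<close>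

definition mono_space :: "('v \<Rightarrow>\<^sub>0 nat) set \<Rightarrow> ('v, 'a::field) mpoly set" where
  "mono_space M = mpoly.span ((\<lambda>m. Poly_Mapping.single m 1) ` M)"

text \<open>A tuple $(Q_0,\dots,Q_n)$ is a sequence that vanishes beyond index \<open>n\<close>.\<close>

definition U_space :: "nat \<Rightarrow> nat \<Rightarrow> nat \<Rightarrow> (nat \<Rightarrow> (nat, 'a::field) mpoly) set" where
  "U_space n d k = {Q. (\<forall>j\<le>n. Q j \<in> mono_space (C_set n d k j)) \<and> (\<forall>j>n. Q j = 0)}"

definition W_space :: "nat \<Rightarrow> nat \<Rightarrow> nat \<Rightarrow> (nat, 'a::field) mpoly set" where
  "W_space n d k = mono_space (R_set n d k)"

text \<open>
  Here \<open>P\<close> is viewed as a polynomial over the field \<^typ>\<open>'k poly fract\<close> of rational functions in $t$.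
  On $V_k$ the map \<^term>\<open>proj (R_set n d k)\<close> is $\pi$; so \<open>phi\<close> is defined on all
  tuples of polynomials and restricts to $\phi_k$ on $U_k$.
\<close>

definition phi :: "nat \<Rightarrow> nat \<Rightarrow> nat \<Rightarrow> (nat, 'k::field poly) mpoly
    \<Rightarrow> (nat \<Rightarrow> (nat, 'k poly fract) mpoly) \<Rightarrow> (nat, 'k poly fract) mpoly" where
  "phi n d k P Q =
     proj (R_set n d k) (\<Sum>j\<le>n. Q j * pderiv_mpoly j (Poly_Mapping.map to_fract P))"

end

theory Submission
  imports Defs
begin

text \<open>
  In monomial bases $\phi_k$ becomes a square matrix over $K[t]$, and at the diagonal fibre this
  matrix is diagonal with nonzero entries; so its determinant is a nonzero polynomial in $t$ and
  the matrix is invertible over $K(t)$.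

  The basis of $U_k$ consists of the pairs $(j, c)$ with $c \in C_k^{(j)}$. The map
  $(j, c) \mapsto c \cdot x_j^{d-1}$ is a bijection onto $R_k$: the index $j$ is recovered from
  the product \<open>u\<close> as the first variable whose exponent is at least $d - 1$, because the
  definition of $C_k^{(j)}$ keeps the exponents of the earlier variables below $d - 1$
  (\<open>R_set_decompose\<close>, \<open>C_set_shift\<close>). So both sides are indexed by the finite set $R_k$. For
  $P_{t_0} = \sum_i \alpha_i x_i^d$ the basis vector $(j, c)$ is sent to
  $c \cdot \partial_j P_{t_0} = d \alpha_j\, c\, x_j^{d-1}$, which is a multiple of the monomial
  with the same index; and $d \alpha_j \neq 0$ since the characteristic is zero
  (\<open>heval_matrix_entry\<close>).

  The diagonal fibre may lie over $t_0 = \infty$, so specialisation is done with homogeneous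
  coordinates $(a : b)$: polynomials in $t$ of degree at most $N$ are viewed as binary forms of
  degree $N$. Instead of the determinant, the proof uses a descent (\<open>kernel_trivial_poly\<close>).
  A vector in the kernel, cleared of denominators, is a vector of forms of some degree $N$. Its
  value at $(a : b)$ is in the kernel of the specialised matrix, hence zero, hence all entries are
  divisible by $b t - a$. The quotient is a kernel vector of degree $N - 1$, and the descent ends
  with zero. So $\phi_k$ is injective, and surjectivity follows by counting dimensions
  (\<open>independent_family_spans\<close>).
\<close>

section \<open>Homogeneous evaluation\<close>

text \<open>
  The value at $(a, b)$ of the binary form $T_1^N f(T_0/T_1)$, for \<open>f\<close> of degree at most \<open>N\<close>.
  The formal degree \<open>N\<close> is a parameter because at $(1 : 0)$, the point $t = \infty$, the value is
  the coefficient of $t^N$ even if that is not the leading coefficient.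
\<close>

definition heval :: "'a::comm_ring_1 \<Rightarrow> 'a \<Rightarrow> nat \<Rightarrow> 'a poly \<Rightarrow> 'a" where
  "heval a b N f = (\<Sum>i\<le>N. poly.coeff f i * a ^ i * b ^ (N - i))"

lemma heval_0 [simp]: "heval a b N 0 = 0"
  by (simp add: heval_def)

lemma heval_add: "heval a b N (f + g) = heval a b N f + heval a b N g"
  by (simp add: heval_def algebra_simps sum.distrib)

lemma heval_sum: "heval a b N (\<Sum>i\<in>I. f i) = (\<Sum>i\<in>I. heval a b N (f i))"
  by (induction I rule: infinite_finite_induct) (simp_all add: heval_add)

lemma heval_affine:
  fixes a b :: "'a::field"
  assumes "Polynomial.degree f \<le> N" and "b \<noteq> 0"
  shows "heval a b N f = b ^ N * poly f (a / b)"
proof -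
  have "poly f (a / b) = (\<Sum>i\<le>N. poly.coeff f i * (a / b) ^ i)"
    unfolding poly_altdef using assms(1)
    by (intro sum.mono_neutral_left) (auto simp: coeff_eq_0)
  then show ?thesis
    using assms(2)
    by (auto simp: heval_def sum_distrib_left power_divide power_diff intro!: sum.cong)
qed

lemma heval_infinity: "heval a 0 N f = poly.coeff f N * a ^ N"
proof -
  have "heval a 0 N f = (\<Sum>i\<in>{N}. poly.coeff f i * a ^ i * 0 ^ (N - i))"
    unfolding heval_def by (rule sum.mono_neutral_right) (auto simp: power_0_left)
  then show ?thesis by simp
qed

lemma heval_mult:
  fixes a b :: "'a::field"
  assumes f: "Polynomial.degree f \<le> N" and g: "Polynomial.degree g \<le> M"
  shows "heval a b (N + M) (f * g) = heval a b N f * heval a b M g"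
proof (cases "b = 0")
  case False
  have "Polynomial.degree (f * g) \<le> N + M"
    using degree_mult_le[of f g] f g by linarith
  with False f g show ?thesis
    by (simp add: heval_affine power_add)
next
  case True
  have "poly.coeff (f * g) (N + M) = (\<Sum>i\<in>{N}. poly.coeff f i * poly.coeff g (N + M - i))"
    unfolding coeff_mult
  proof (rule sum.mono_neutral_right)
    show "\<forall>i\<in>{..N + M} - {N}. poly.coeff f i * poly.coeff g (N + M - i) = 0"
    proof
      fix i assume "i \<in> {..N + M} - {N}"
      then have "N < i \<or> M < N + M - i" by auto
      then show "poly.coeff f i * poly.coeff g (N + M - i) = 0"
        using f g by (auto simp: coeff_eq_0)
    qed
  qed auto
  with True show ?thesis by (simp add: heval_infinity power_add)
qed

text \<open>
  A binary form that vanishes at $(a : b)$ is divisible by $b T_0 - a T_1$. At $t = \infty$ this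
  linear form dehomogenises to the constant $-a$, and the bound on the degree of \<open>h\<close> expresses that
  the coefficient of $t^N$ in \<open>f\<close> is zero. The last conjunct covers the forms of degree $0$, for
  which $N - 1$ is truncated: they are constants, equal to their value.
\<close>

lemma heval_eq_0_imp_factor:
  fixes a b :: "'a::field"
  assumes ab: "a \<noteq> 0 \<or> b \<noteq> 0" and f: "Polynomial.degree f \<le> N" and z: "heval a b N f = 0"
  shows "\<exists>h. f = [:- a, b:] * h \<and> Polynomial.degree h \<le> N - 1 \<and> (N = 0 \<longrightarrow> f = 0)"
proof (cases "b = 0")
  case True
  then have a: "a \<noteq> 0" and c: "poly.coeff f N = 0"
    using ab z by (auto simp: heval_infinity)
  have "f = [:- a, b:] * Polynomial.smult (- inverse a) f"
    using True a by simp
  moreover have "Polynomial.degree f \<le> N - 1 \<and> (N = 0 \<longrightarrow> f = 0)"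
  proof (cases "f = 0")
    case False
    then have "Polynomial.degree f \<noteq> N" using c by auto
    then show ?thesis using f by auto
  qed auto
  ultimately show ?thesis
    using a by (intro exI[of _ "Polynomial.smult (- inverse a) f"]) auto
next
  case False
  then have "poly f (a / b) = 0"
    using z f by (auto simp: heval_affine)
  then obtain h where h: "f = [:- (a / b), 1:] * h"
    by (auto simp: poly_eq_0_iff_dvd elim: dvdE)
  have "[:- a, b:] = Polynomial.smult b [:- (a / b), 1:]"
    using False by simp
  then have "f = [:- a, b:] * Polynomial.smult (inverse b) h"
    using h False by (simp only: mult_smult_left mult_smult_right smult_smult) simp
  moreover have "Polynomial.degree h \<le> N - 1 \<and> (N = 0 \<longrightarrow> f = 0)"
  proof (cases "h = 0")
    case False
    then have "Polynomial.degree f = Suc (Polynomial.degree h)"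
      unfolding h by (subst degree_mult_eq) auto
    then show ?thesis using f by auto
  qed (auto simp: h)
  ultimately show ?thesis
    using False by (intro exI[of _ "Polynomial.smult (inverse b) h"]) auto
qed

section \<open>Kernels and dimension counts\<close>

text \<open>
  Infinite descent on the degree \<open>N\<close> of a kernel vector: evaluating the equations at $(a : b)$ shows
  that every entry vanishes there, so $b t - a$ can be cancelled from the whole vector.
\<close>

lemma kernel_trivial_poly:
  fixes M :: "'i \<Rightarrow> 'i \<Rightarrow> 'a::field poly"
  assumes ab: "a \<noteq> 0 \<or> b \<noteq> 0"
    and deg: "\<And>u w. u \<in> I \<Longrightarrow> w \<in> I \<Longrightarrow> Polynomial.degree (M u w) \<le> e"
    and special: "\<And>u w. u \<in> I \<Longrightarrow> w \<in> I \<Longrightarrow> heval a b e (M u w) = (if u = w then \<beta> u else 0)"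
    and \<beta>: "\<And>u. u \<in> I \<Longrightarrow> \<beta> u \<noteq> 0"
    and fin: "finite I"
    and "\<And>u. u \<in> I \<Longrightarrow> Polynomial.degree (g u) \<le> N"
    and "\<And>w. w \<in> I \<Longrightarrow> (\<Sum>u\<in>I. g u * M u w) = 0"
  shows "\<forall>u\<in>I. g u = 0"
  using assms(6,7)
proof (induction N arbitrary: g rule: less_induct)
  case (less N)
  have "heval a b N (g w) = 0" if w: "w \<in> I" for w
  proof -
    have "0 = heval a b (N + e) (\<Sum>u\<in>I. g u * M u w)"
      using less.prems(2)[OF w] by simp
    also have "\<dots> = (\<Sum>u\<in>I. heval a b N (g u) * (if u = w then \<beta> u else 0))"
      using w less.prems(1) deg special by (simp add: heval_sum heval_mult)
    also have "\<dots> = heval a b N (g w) * \<beta> w"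
      using w fin by (simp add: if_distrib[of "(*) _"] cong: if_cong)
    finally show ?thesis using \<beta>[OF w] by auto
  qed
  then have "\<forall>u\<in>I. \<exists>h. g u = [:- a, b:] * h \<and> Polynomial.degree h \<le> N - 1 \<and> (N = 0 \<longrightarrow> g u = 0)"
    using heval_eq_0_imp_factor[OF ab] less.prems(1) by blast
  then obtain h where h: "\<And>u. u \<in> I \<Longrightarrow> g u = [:- a, b:] * h u"
    "\<And>u. u \<in> I \<Longrightarrow> Polynomial.degree (h u) \<le> N - 1" "\<And>u. u \<in> I \<Longrightarrow> N = 0 \<longrightarrow> g u = 0"
    by metis
  show ?case
  proof (cases "N = 0")
    case True
    then show ?thesis using h(3) by blast
  next
    case False
    have "(\<Sum>u\<in>I. h u * M u w) = 0" if w: "w \<in> I" for w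
    proof -
      have "[:- a, b:] * (\<Sum>u\<in>I. h u * M u w) = (\<Sum>u\<in>I. g u * M u w)"
        unfolding sum_distrib_left by (intro sum.cong) (simp_all only: h(1) mult.assoc)
      also have "\<dots> = 0" using less.prems(2)[OF w] .
      finally have "[:- a, b:] = 0 \<or> (\<Sum>u\<in>I. h u * M u w) = 0"
        by (simp only: mult_eq_0_iff)
      then show ?thesis using ab by auto
    qed
    then have "\<forall>u\<in>I. h u = 0"
      using less.IH[of "N - 1" h] h(2) False by auto
    then show ?thesis using h(1) by simp
  qed
qed

lemma common_denominator:
  fixes q :: "'i \<Rightarrow> 'a::idom fract"
  assumes "finite I"
  shows "\<exists>D g. D \<noteq> 0 \<and> (\<forall>u\<in>I. to_fract D * q u = to_fract (g u))"
proof -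
  have "\<exists>x y. y \<noteq> 0 \<and> to_fract y * q u = to_fract x" for u
  proof (cases "q u")
    case (Fract x y)
    then show ?thesis by (intro exI[of _ x] exI[of _ y]) (simp add: Fract_conv_to_fract)
  qed
  then obtain x y where xy: "\<And>u. y u \<noteq> 0" "\<And>u. to_fract (y u) * q u = to_fract (x u)"
    by metis
  have "to_fract (prod y I) * q u = to_fract (x u * prod y (I - {u}))" if "u \<in> I" for u
    using assms that xy(2)[of u] by (simp add: prod.remove[of I u] mult_ac)
  moreover have "prod y I \<noteq> 0" using assms xy(1) by simp
  ultimately show ?thesis
    by (intro exI[of _ "prod y I"] exI[of _ "\<lambda>u. x u * prod y (I - {u})"]) blast
qed

lemma kernel_trivial_fract:
  fixes M :: "'i \<Rightarrow> 'i \<Rightarrow> 'a::field poly"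
  assumes ab: "a \<noteq> 0 \<or> b \<noteq> 0"
    and deg: "\<And>u w. u \<in> I \<Longrightarrow> w \<in> I \<Longrightarrow> Polynomial.degree (M u w) \<le> e"
    and special: "\<And>u w. u \<in> I \<Longrightarrow> w \<in> I \<Longrightarrow> heval a b e (M u w) = (if u = w then \<beta> u else 0)"
    and \<beta>: "\<And>u. u \<in> I \<Longrightarrow> \<beta> u \<noteq> 0"
    and fin: "finite I"
    and ker: "\<And>w. w \<in> I \<Longrightarrow> (\<Sum>u\<in>I. q u * to_fract (M u w)) = 0"
  shows "\<forall>u\<in>I. q u = 0"
proof -
  obtain D g where D: "D \<noteq> 0" and g: "\<And>u. u \<in> I \<Longrightarrow> to_fract D * q u = to_fract (g u)"
    using common_denominator[OF fin, of q] by blast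
  have "(\<Sum>u\<in>I. g u * M u w) = 0" if w: "w \<in> I" for w
  proof -
    have "to_fract (\<Sum>u\<in>I. g u * M u w) = to_fract D * (\<Sum>u\<in>I. q u * to_fract (M u w))"
      by (simp add: g[symmetric] sum_distrib_left mult.assoc)
    also have "\<dots> = 0" using ker[OF w] by simp
    finally show ?thesis by (simp only: to_fract_eq_0_iff)
  qed
  moreover have "Polynomial.degree (g u) \<le> Max ((\<lambda>u. Polynomial.degree (g u)) ` I)" if "u \<in> I" for u
    using that fin by simp
  ultimately have "\<forall>u\<in>I. g u = 0"
    using kernel_trivial_poly[OF ab deg special \<beta> fin, where g = g] by blast
  then show ?thesis using g D by force
qed

text \<open>
  Exchange argument: a vector outside the span of the family would extend it to an independent set
  with more elements than the spanning set \<open>B\<close>. The family is indexed, so that independence also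
  excludes repetitions.
\<close>

lemma (in vector_space) independent_family_spans:
  assumes fin: "finite I" "finite B" and card: "card B \<le> card I"
    and v: "\<And>i. i \<in> I \<Longrightarrow> v i \<in> span B"
    and indep: "\<And>q. (\<Sum>i\<in>I. scale (q i) (v i)) = 0 \<Longrightarrow> \<forall>i\<in>I. q i = 0"
    and w: "w \<in> span B"
  shows "\<exists>q. w = (\<Sum>i\<in>I. scale (q i) (v i))"
proof -
  have inj: "inj_on v I"
  proof (rule inj_onI, rule ccontr)
    fix i j assume ij: "i \<in> I" "j \<in> I" "v i = v j" "i \<noteq> j"
    let ?q = "\<lambda>x. (if x = i then 1 else 0) - (if x = j then 1 else 0)"
    have "(\<Sum>x\<in>I. scale (?q x) (v x)) = 0"
      using ij fin
      by (simp add: scale_left_diff_distrib sum_subtractf if_distrib[of "\<lambda>c. scale c _"] cong: if_cong)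
    then show False using indep[of ?q] ij by auto
  qed
  have ind: "independent (v ` I)"
  proof (rule independent_if_scalars_zero)
    fix f x assume "(\<Sum>x\<in>v ` I. scale (f x) x) = 0" "x \<in> v ` I"
    then show "f x = 0"
      using indep[of "f \<circ> v"] by (auto simp: sum.reindex[OF inj] o_def)
  qed (use fin in simp)
  have "w \<in> span (v ` I)"
  proof (rule ccontr)
    assume not_span: "w \<notin> span (v ` I)"
    then have "independent (insert w (v ` I))"
      using ind by (rule independent_insertI)
    moreover have "insert w (v ` I) \<subseteq> span B" using v w by auto
    ultimately have "card (insert w (v ` I)) \<le> card B"
      using independent_span_bound fin by blast
    moreover have "w \<notin> v ` I" using not_span span_base by blast
    ultimately show False using card fin inj by (simp add: card_image)
  qed
  then obtain f where "w = (\<Sum>x\<in>v ` I. scale (f x) x)"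
    using fin by (auto simp: span_finite)
  then have "w = (\<Sum>i\<in>I. scale (f (v i)) (v i))"
    by (simp add: sum.reindex[OF inj])
  then show ?thesis by (intro exI[of _ "\<lambda>i. f (v i)"])
qed

section \<open>Coefficients of polynomials in several variables\<close>

lemma lookup_map_zero: "f 0 = 0 \<Longrightarrow> lookup (Poly_Mapping.map f F) m = f (lookup F m)"
  by (simp add: Poly_Mapping.map.rep_eq when_def)

lemma lookup_proj: "lookup (proj M F) m = (if m \<in> M then lookup F m else 0)"
proof -
  have "lookup (proj M F) m = (\<Sum>k\<in>keys F \<inter> M. if k = m then lookup F k else 0)"
    by (simp add: proj_def lookup_sum lookup_single when_def)
  also have "\<dots> = (if m \<in> M then lookup F m else 0)"
    by (auto simp: sum.delta in_keys_iff)
  finally show ?thesis .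
qed

lemma lookup_mscale [simp]: "lookup (mscale c F) m = c * lookup F m"
  by (simp add: mscale_def lookup_map_zero)

lemma lookup_single_times:
  fixes F :: "('v, 'a::comm_semiring_1) mpoly"
  shows "lookup (Poly_Mapping.single m c * F) w = (if m + (w - m) = w then c * lookup F (w - m) else 0)"
proof -
  have "lookup (Poly_Mapping.single m c * F) w
      = Sum_any (\<lambda>l. (c * Sum_any (\<lambda>x. lookup F x when w = m + x)) when l = m)"
    unfolding lookup_mult
    by (rule Sum_any.cong) (auto simp: lookup_single when_def)
  also have "\<dots> = c * Sum_any (\<lambda>x. lookup F x when w = m + x)"
    by simp
  also have "Sum_any (\<lambda>x. lookup F x when w = m + x)
      = Sum_any (\<lambda>x. (lookup F (w - m) when m + (w - m) = w) when x = w - m)"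
    by (rule Sum_any.cong) (auto simp: when_def)
  also have "\<dots> = (lookup F (w - m) when m + (w - m) = w)"
    by simp
  finally show ?thesis by (simp add: when_def)
qed

lemma lookup_pderiv:
  fixes F :: "('v, 'a::comm_semiring_1) mpoly"
  shows "lookup (pderiv_mpoly v F) m
    = of_nat (Suc (lookup m v)) * lookup F (m + Poly_Mapping.single v 1)"
proof -
  let ?e = "Poly_Mapping.single v (1::nat)"
  \<comment> \<open>For \<open>k\<close> free of \<open>v\<close>, truncated subtraction returns \<open>k\<close> itself; the factor
    \<open>lookup k v = 0\<close> removes these terms.\<close>
  have *: "(of_nat (lookup k v) * lookup F k when k - ?e = m)
      = (if k = m + ?e then of_nat (lookup k v) * lookup F k else 0)" for k
  proof (cases "lookup k v = 0")
    case True
    then have "k \<noteq> m + ?e" by (auto simp: lookup_add)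
    with True show ?thesis by simp
  next
    case False
    then have "k = (k - ?e) + ?e"
      by (intro poly_mapping_eqI) (auto simp: lookup_add lookup_minus lookup_single when_def)
    then have "k - ?e = m \<longleftrightarrow> k = m + ?e"
      by (metis add_diff_cancel_right')
    then show ?thesis by (auto simp: when_def)
  qed
  have "lookup (pderiv_mpoly v F) m
      = (\<Sum>k\<in>keys F. if k = m + ?e then of_nat (lookup k v) * lookup F k else 0)"
    unfolding pderiv_mpoly_def lookup_sum lookup_single * ..
  also have "\<dots> = of_nat (lookup (m + ?e) v) * lookup F (m + ?e)"
    by (simp add: in_keys_iff)
  finally show ?thesis by (simp add: lookup_add add.commute)
qed

lemma pderiv_add:
  fixes F G :: "('v, 'a::comm_semiring_1) mpoly"
  shows "pderiv_mpoly v (F + G) = pderiv_mpoly v F + pderiv_mpoly v G"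
  by (intro poly_mapping_eqI) (simp add: lookup_pderiv lookup_add algebra_simps)

lemma pderiv_single:
  "pderiv_mpoly v (Poly_Mapping.single m c)
    = Poly_Mapping.single (m - Poly_Mapping.single v 1) (of_nat (lookup m v) * c)"
  by (cases "c = 0") (simp_all add: pderiv_mpoly_def)

lemma pderiv_sum:
  fixes F :: "'i \<Rightarrow> ('v, 'a::comm_semiring_1) mpoly"
  shows "pderiv_mpoly v (\<Sum>i\<in>I. F i) = (\<Sum>i\<in>I. pderiv_mpoly v (F i))"
proof -
  have "pderiv_mpoly v 0 = (0 :: ('v, 'a) mpoly)" by (simp add: pderiv_mpoly_def)
  then show ?thesis
    by (induction I rule: infinite_finite_induct) (simp_all add: pderiv_add)
qed

lemma var_power: "var i ^ d = Poly_Mapping.single (Poly_Mapping.single i d) 1"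
  by (induction d) (simp_all add: var_def mult_single single_add[symmetric])

lemma mscale_single: "mscale c (Poly_Mapping.single m x) = Poly_Mapping.single m (c * x)"
  by (intro poly_mapping_eqI) (simp add: lookup_single when_def)

lemma pderiv_diagonal:
  fixes j n :: nat
  assumes "j \<le> n"
  shows "pderiv_mpoly j (\<Sum>i\<le>n. mscale (\<alpha> i) (var i ^ d))
    = Poly_Mapping.single (Poly_Mapping.single j (d - 1)) (of_nat d * \<alpha> j)"
proof -
  have "pderiv_mpoly j (\<Sum>i\<le>n. mscale (\<alpha> i) (var i ^ d)) = (\<Sum>i\<le>n. if i = j then
      Poly_Mapping.single (Poly_Mapping.single j (d - 1)) (of_nat d * \<alpha> j) else 0)"
    unfolding pderiv_sum
    by (intro sum.cong)
      (auto simp: var_power mscale_single pderiv_single lookup_single when_def single_diff[symmetric])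
  with assms show ?thesis by (simp del: One_nat_def)
qed

text \<open>
  The entries of the matrix of $\phi_k$ are coefficients of these polynomials. Each such coefficient
  is an integer multiple of a single coefficient of \<open>F\<close>. So forming it commutes with every
  additive map on coefficients, in particular with the embedding of $K[t]$ into $K(t)$ and with
  homogeneous evaluation, which is not multiplicative for a fixed formal degree.
\<close>

definition shifted_pderiv :: "('v \<Rightarrow>\<^sub>0 nat) \<Rightarrow> 'v \<Rightarrow> ('v, 'a) mpoly \<Rightarrow> ('v, 'a::comm_ring_1) mpoly" where
  "shifted_pderiv m j F = Poly_Mapping.single m 1 * pderiv_mpoly j F"

lemma lookup_shifted_pderiv:
  "lookup (shifted_pderiv m j F) w = (if m + (w - m) = w then
     of_nat (Suc (lookup (w - m) j)) * lookup F (w - m + Poly_Mapping.single j 1) else 0)"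
  by (simp add: shifted_pderiv_def lookup_single_times lookup_pderiv del: of_nat_Suc)

lemma lookup_shifted_pderiv_map:
  assumes zero: "f 0 = 0" and add: "\<And>x y. f (x + y) = f x + f y"
  shows "lookup (shifted_pderiv m j (Poly_Mapping.map f F)) w = f (lookup (shifted_pderiv m j F) w)"
proof -
  have "f (of_nat k * x) = of_nat k * f x" for k x
    by (induction k) (simp_all add: zero add distrib_right)
  then show ?thesis
    by (simp add: lookup_shifted_pderiv lookup_map_zero zero del: of_nat_Suc)
qed

lemma degree_lookup_le_tdegree: "Polynomial.degree (lookup P m) \<le> tdegree P"
proof (cases "m \<in> keys P")
  case True
  then show ?thesis unfolding tdegree_def by (intro Max_ge) auto
qed (simp add: in_keys_iff)

lemma degree_lookup_shifted_pderiv: "Polynomial.degree (lookup (shifted_pderiv m j P) w) \<le> tdegree P"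
proof -
  have "Polynomial.degree (of_nat k * f) \<le> Polynomial.degree f" for k and f :: "'a::comm_ring_1 poly"
    using degree_mult_le[of "of_nat k" f] by simp
  then show ?thesis
    unfolding lookup_shifted_pderiv
    using degree_lookup_le_tdegree[of P] by (auto simp del: of_nat_Suc intro: order_trans)
qed

text \<open>
  The fibre over $(a : b)$ is obtained by evaluating all coefficients as forms of the same degree,
  which makes it accessible to \<open>lookup_shifted_pderiv_map\<close>.
\<close>

lemma fibre_eq_conv_map: "fibre_eq P a b = Poly_Mapping.map (heval a b (tdegree P)) P"
proof (rule poly_mapping_eqI)
  fix m
  have "lookup (fibre_eq P a b) m
      = (\<Sum>k\<in>keys P. if k = m then heval a b (tdegree P) (lookup P k) else 0)"
    by (simp add: fibre_eq_def heval_def lookup_sum lookup_single when_def)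
  also have "\<dots> = heval a b (tdegree P) (lookup P m)"
    by (auto simp: in_keys_iff)
  finally show "lookup (fibre_eq P a b) m = lookup (Poly_Mapping.map (heval a b (tdegree P)) P) m"
    by (simp add: lookup_map_zero)
qed

lemma mono_space_eq: "mono_space M = {F :: ('v, 'a::field) mpoly. keys F \<subseteq> M}"
proof (intro equalityI subsetI)
  fix F :: "('v, 'a) mpoly"
  assume "F \<in> mono_space M"
  then show "F \<in> {F. keys F \<subseteq> M}"
    unfolding mono_space_def
  proof (induction rule: mpoly.span_induct_alt)
    case (step c x y)
    then show ?case by (auto simp: in_keys_iff lookup_add lookup_single when_def split: if_splits)
  qed simp
next
  fix F :: "('v, 'a) mpoly"
  assume F: "F \<in> {F. keys F \<subseteq> M}"
  have "F = (\<Sum>m\<in>keys F. mscale (lookup F m) (Poly_Mapping.single m 1))"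
    by (intro poly_mapping_eqI) (simp add: mscale_single lookup_sum lookup_single when_def in_keys_iff)
  moreover have "(\<Sum>m\<in>keys F. mscale (lookup F m) (Poly_Mapping.single m 1)) \<in> mono_space M"
    unfolding mono_space_def using F
    by (intro mpoly.span_sum mpoly.span_scale mpoly.span_base) auto
  ultimately show "F \<in> mono_space M" by simp
qed

section \<open>Matching the monomial bases\<close>

text \<open>
  The inverse of $(j, c) \mapsto c \cdot x_j^{d-1}$ sends \<open>u\<close> to
  \<open>(first_large d u, cofactor d u)\<close>.
\<close>

definition first_large :: "nat \<Rightarrow> (nat \<Rightarrow>\<^sub>0 nat) \<Rightarrow> nat" where
  "first_large d u = (LEAST j. d - 1 \<le> lookup u j)"

definition cofactor :: "nat \<Rightarrow> (nat \<Rightarrow>\<^sub>0 nat) \<Rightarrow> (nat \<Rightarrow>\<^sub>0 nat)" where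
  "cofactor d u = u - Poly_Mapping.single (first_large d u) (d - 1)"

lemma mem_C_set_iff: "c \<in> C_set n d k j \<longleftrightarrow> c \<in> C_set n d k 0 \<and> (\<forall>i<j. lookup c i < d - 1)"
  by (induction j) (auto simp: less_Suc_eq not_le simp del: C_set.simps(1))

lemma mdeg_add_single:
  fixes j n :: nat
  assumes "j \<le> n"
  shows "mdeg {..n} (c + Poly_Mapping.single j x) = mdeg {..n} c + x"
  using assms by (simp add: mdeg_def lookup_add sum.distrib lookup_single when_def)

text \<open>
  Some exponent of a monomial in $R_k$ is at least $d - 1$. Dividing by the power $x_j^{d-1}$ of the
  first such variable leaves all earlier exponents below $d - 1$, as $C_k^{(j)}$ requires.
\<close>

lemma R_set_decompose:
  assumes u: "u \<in> R_set n d k" and d: "d \<ge> 1"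
  shows "first_large d u \<le> n"
    and "cofactor d u + Poly_Mapping.single (first_large d u) (d - 1) = u"
    and "cofactor d u \<in> C_set n d k (first_large d u)"
proof -
  let ?j = "first_large d u"
  obtain i where i: "i \<le> n" "d - 1 \<le> lookup u i"
    using u by (auto simp: R_set_def B_set_def not_less)
  have large: "d - 1 \<le> lookup u ?j"
    unfolding first_large_def using i(2) by (rule LeastI)
  show j: "?j \<le> n"
    unfolding first_large_def using i by (meson Least_le order_trans)
  show eq: "cofactor d u + Poly_Mapping.single ?j (d - 1) = u"
    using large
    by (intro poly_mapping_eqI) (auto simp: cofactor_def lookup_add lookup_minus lookup_single when_def)
  have "lookup (cofactor d u) i < d - 1" if "i < ?j" for i
    using that not_less_Least[of i "\<lambda>j. d - 1 \<le> lookup u j"]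
    by (auto simp: cofactor_def first_large_def lookup_minus lookup_single when_def)
  moreover have "cofactor d u \<in> C_set n d k 0"
  proof -
    have "keys (cofactor d u) \<subseteq> {..n}"
      using u by (auto simp: cofactor_def R_set_def F_set_def in_keys_iff lookup_minus subset_iff)
    moreover have "mdeg {..n} u = mdeg {..n} (cofactor d u) + (d - 1)"
      using mdeg_add_single[OF j, of "cofactor d u" "d - 1"] eq by simp
    ultimately show ?thesis
      using u d by (auto simp: R_set_def F_set_def of_nat_diff algebra_simps)
  qed
  ultimately show "cofactor d u \<in> C_set n d k ?j"
    by (subst mem_C_set_iff) blast
qed

lemma C_set_shift:
  assumes c: "c \<in> C_set n d k j" and j: "j \<le> n" and d: "d \<ge> 1"
  defines "u \<equiv> c + Poly_Mapping.single j (d - 1)"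
  shows "u \<in> R_set n d k" and "first_large d u = j" and "cofactor d u = c"
proof -
  have c0: "c \<in> C_set n d k 0" and small: "\<And>i. i < j \<Longrightarrow> lookup c i < d - 1"
    using c mem_C_set_iff by blast+
  have "u \<in> F_set n d k"
  proof -
    have "keys u \<subseteq> {..n}"
      using c0 j by (auto simp: u_def in_keys_iff lookup_add lookup_single when_def subset_iff split: if_splits)
    moreover have "mdeg {..n} u = mdeg {..n} c + (d - 1)"
      unfolding u_def by (rule mdeg_add_single[OF j])
    ultimately show ?thesis
      using c0 d by (auto simp: F_set_def of_nat_diff algebra_simps)
  qed
  moreover have "d - 1 \<le> lookup u j"
    by (simp add: u_def lookup_add)
  ultimately show "u \<in> R_set n d k"
    using j by (auto simp: R_set_def B_set_def not_less)
  show *: "first_large d u = j"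
    unfolding first_large_def
  proof (rule Least_equality)
    show "d - 1 \<le> lookup u j" by fact
    show "j \<le> i" if "d - 1 \<le> lookup u i" for i
      using that small[of i] by (cases "i < j") (auto simp: u_def lookup_add lookup_single when_def)
  qed
  show "cofactor d u = c"
    unfolding cofactor_def * by (simp add: u_def)
qed

lemma finite_F_set: "finite (F_set n d k)"
proof -
  define D where "D = nat (int k * int d - (int n + 1))"
  have bound: "lookup u i \<le> D" if u: "u \<in> F_set n d k" and i: "i \<le> n" for u i
  proof -
    have "lookup u i \<le> mdeg {..n} u"
      unfolding mdeg_def using i by (intro member_le_sum) auto
    then show ?thesis using u by (auto simp: F_set_def D_def)
  qed
  let ?r = "\<lambda>u. restrict (lookup u) {..n}"
  have "?r ` F_set n d k \<subseteq> {..n} \<rightarrow>\<^sub>E {..D}"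
    using bound by (auto simp: PiE_def extensional_def)
  then have "finite (?r ` F_set n d k)"
    by (rule finite_subset) (auto intro: finite_PiE)
  moreover have "inj_on ?r (F_set n d k)"
  proof (rule inj_onI, rule poly_mapping_eqI)
    fix u v i assume *: "u \<in> F_set n d k" "v \<in> F_set n d k" "?r u = ?r v"
    show "lookup u i = lookup v i"
    proof (cases "i \<le> n")
      case True
      then show ?thesis using fun_cong[OF *(3), of i] by simp
    next
      case False
      then have "i \<notin> keys u" "i \<notin> keys v"
        using *(1,2) by (auto simp: F_set_def)
      then show ?thesis by (simp add: in_keys_iff)
    qed
  qed
  ultimately show ?thesis by (rule finite_imageD)
qed

lemma finite_R_set: "finite (R_set n d k)"
  unfolding R_set_def using finite_F_set by blast

text \<open>
  A function \<open>q\<close> on $R_k$ is a coordinate vector on $U_k$: \<open>q u\<close> is the coefficient of the basis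
  vector that corresponds to \<open>u\<close>.
\<close>

definition tuple_of :: "nat \<Rightarrow> nat \<Rightarrow> nat \<Rightarrow> ((nat \<Rightarrow>\<^sub>0 nat) \<Rightarrow> 'a::field) \<Rightarrow> nat \<Rightarrow> (nat, 'a) mpoly" where
  "tuple_of n d k q j = (\<Sum>u\<in>{u \<in> R_set n d k. first_large d u = j}. Poly_Mapping.single (cofactor d u) (q u))"

lemma lookup_tuple_of:
  assumes d: "d \<ge> 1" and j: "j \<le> n"
  shows "lookup (tuple_of n d k q j) c
    = (if c \<in> C_set n d k j then q (c + Poly_Mapping.single j (d - 1)) else 0)"
proof -
  let ?I = "{u \<in> R_set n d k. first_large d u = j}"
  let ?u = "c + Poly_Mapping.single j (d - 1)"
  have iff: "u \<in> ?I \<and> cofactor d u = c \<longleftrightarrow> c \<in> C_set n d k j \<and> u = ?u" for u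
    using R_set_decompose(2,3)[OF _ d, of u n k] C_set_shift[OF _ j d, of c k] by auto
  have "lookup (tuple_of n d k q j) c = (\<Sum>u\<in>?I. if cofactor d u = c then q u else 0)"
    by (simp add: tuple_of_def lookup_sum lookup_single when_def)
  also have "\<dots> = (\<Sum>u\<in>?I \<inter> {u. cofactor d u = c}. q u)"
    using finite_R_set by (subst sum.inter_restrict) simp_all
  also have "?I \<inter> {u. cofactor d u = c} = (if c \<in> C_set n d k j then {?u} else {})"
    using iff by auto
  finally show ?thesis by simp
qed

lemma tuple_of_mem_U_space:
  assumes d: "d \<ge> 1"
  shows "tuple_of n d k q \<in> U_space n d k"
proof -
  have "tuple_of n d k q j \<in> mono_space (C_set n d k j)" if "j \<le> n" for j
    using that d by (auto simp: mono_space_eq in_keys_iff lookup_tuple_of split: if_splits)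
  moreover have "tuple_of n d k q j = 0" if "j > n" for j
    unfolding tuple_of_def
    using that R_set_decompose(1)[OF _ d, of _ n k] by (intro sum.neutral) force
  ultimately show ?thesis by (simp add: U_space_def)
qed

lemma U_space_eq_range:
  assumes d: "d \<ge> 1"
  shows "U_space n d k = range (tuple_of n d k)"
proof (intro equalityI subsetI)
  fix Q :: "nat \<Rightarrow> (nat, 'a::field) mpoly"
  assume Q: "Q \<in> U_space n d k"
  let ?q = "\<lambda>u. lookup (Q (first_large d u)) (cofactor d u)"
  have "Q j = tuple_of n d k ?q j" for j
  proof (cases "j \<le> n")
    case True
    show ?thesis
    proof (rule poly_mapping_eqI)
      fix c
      show "lookup (Q j) c = lookup (tuple_of n d k ?q j) c"
        using Q True C_set_shift(2,3)[OF _ True d, of c k]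
        by (auto simp: lookup_tuple_of[OF d True] U_space_def mono_space_eq in_keys_iff subset_iff)
    qed
  next
    case False
    then show ?thesis
      using Q tuple_of_mem_U_space[OF d, of n k ?q] by (simp add: U_space_def)
  qed
  then have "Q = tuple_of n d k ?q" by (rule ext)
  then show "Q \<in> range (tuple_of n d k)" by blast
qed (use tuple_of_mem_U_space[OF d] in blast)

section \<open>The matrix of the map and its specialisation\<close>

lemma proj_add: "proj M (F + G) = proj M F + proj M G"
  by (intro poly_mapping_eqI) (simp add: lookup_proj lookup_add)

lemma proj_mscale: "proj M (mscale c F) = mscale c (proj M F)"
  by (intro poly_mapping_eqI) (simp add: lookup_proj)

lemma mscale_times: "mscale c F * G = mscale c (F * G)"
  by (simp add: mscale_def mult_map_scale_conv_mult mult.assoc)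

lemma linear_phi:
  fixes P :: "(nat, 'k::field poly) mpoly"
  shows "Vector_Spaces.linear tscale mscale (phi n d k P)"
  unfolding Vector_Spaces.linear_iff
proof (intro conjI allI)
  show "vector_space (tscale :: 'k poly fract \<Rightarrow> (nat \<Rightarrow> (nat, 'k poly fract) mpoly) \<Rightarrow> _)"
    by unfold_locales
      (simp_all add: tscale_def fun_eq_iff mpoly.scale_right_distrib mpoly.scale_left_distrib)
  show "vector_space (mscale :: 'k poly fract \<Rightarrow> (nat, 'k poly fract) mpoly \<Rightarrow> _)"
    by (rule mpoly.vector_space_axioms)
  show "phi n d k P (Q + Q') = phi n d k P Q + phi n d k P Q'" for Q Q'
    by (simp add: phi_def distrib_right sum.distrib proj_add)
  show "phi n d k P (tscale c Q) = mscale c (phi n d k P Q)" for c Q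
    unfolding phi_def tscale_def mscale_times mpoly.scale_sum_right[symmetric] proj_mscale ..
qed

text \<open>
  The image under $\phi_k$ of the basis vector of $U_k$ that corresponds to \<open>u\<close>
  (see \<open>phi_tuple_of\<close>).
\<close>

definition phi_basis :: "nat \<Rightarrow> nat \<Rightarrow> nat \<Rightarrow> (nat, 'k::field poly) mpoly \<Rightarrow> (nat \<Rightarrow>\<^sub>0 nat) \<Rightarrow> (nat, 'k poly fract) mpoly"
  where "phi_basis n d k P u = proj (R_set n d k)
    (shifted_pderiv (cofactor d u) (first_large d u) (Poly_Mapping.map to_fract P))"

lemma lookup_phi_basis:
  "lookup (phi_basis n d k P u) w = (if w \<in> R_set n d k
     then to_fract (lookup (shifted_pderiv (cofactor d u) (first_large d u) P) w) else 0)"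
  by (simp add: phi_basis_def lookup_proj lookup_shifted_pderiv_map)

lemma phi_tuple_of:
  assumes d: "d \<ge> 1"
  shows "phi n d k P (tuple_of n d k q) = (\<Sum>u\<in>R_set n d k. mscale (q u) (phi_basis n d k P u))"
proof -
  let ?P = "Poly_Mapping.map to_fract P" and ?R = "R_set n d k"
  have "(\<Sum>j\<le>n. tuple_of n d k q j * pderiv_mpoly j ?P)
      = (\<Sum>j\<le>n. \<Sum>u\<in>{u \<in> ?R. first_large d u = j}.
          mscale (q u) (shifted_pderiv (cofactor d u) (first_large d u) ?P))"
    unfolding tuple_of_def sum_distrib_right
    by (intro sum.cong) (auto simp: shifted_pderiv_def mscale_times[symmetric] mscale_single)
  also have "\<dots> = (\<Sum>u\<in>?R. mscale (q u) (shifted_pderiv (cofactor d u) (first_large d u) ?P))"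
    by (rule sum.group) (use finite_R_set R_set_decompose(1)[OF _ d] in auto)
  finally show ?thesis
    unfolding phi_def phi_basis_def
    by (intro poly_mapping_eqI) (simp add: lookup_proj lookup_sum)
qed

text \<open>
  At the diagonal fibre the partial derivative is $d \alpha_j x_j^{d-1}$, and multiplying it by the
  cofactor of \<open>u\<close> gives \<open>u\<close> back. So the specialised matrix is diagonal.
\<close>

lemma heval_matrix_entry:
  assumes d: "d \<ge> 1" and u: "u \<in> R_set n d k"
    and diag: "fibre_eq P a b = (\<Sum>i\<le>n. mscale (\<alpha> i) (var i ^ d))"
  shows "heval a b (tdegree P) (lookup (shifted_pderiv (cofactor d u) (first_large d u) P) w)
    = (if u = w then of_nat d * \<alpha> (first_large d u) else 0)"
proof -
  note R = R_set_decompose[OF u d]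
  have "heval a b (tdegree P) (lookup (shifted_pderiv (cofactor d u) (first_large d u) P) w)
      = lookup (shifted_pderiv (cofactor d u) (first_large d u) (fibre_eq P a b)) w"
    unfolding fibre_eq_conv_map by (rule lookup_shifted_pderiv_map[symmetric]) (simp_all add: heval_add)
  also have "\<dots> = lookup (Poly_Mapping.single u (of_nat d * \<alpha> (first_large d u))) w"
    by (simp add: diag shifted_pderiv_def pderiv_diagonal[OF R(1)] mult_single R(2)
        del: One_nat_def)
  finally show ?thesis by (simp add: lookup_single when_def)
qed

text \<open>
  The family \<open>phi_basis\<close> is independent because its matrix is diagonal at $(a : b)$. It has as many
  members as $W_k$ has basis monomials, hence it is a basis of $W_k$.
\<close>

lemma phi_bij_betw:
  fixes P :: "(nat, 'k::field poly) mpoly"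
  assumes d: "d \<ge> 1" and char: "of_nat d \<noteq> (0 :: 'k)" and ab: "a \<noteq> 0 \<or> b \<noteq> 0"
    and diag: "fibre_eq P a b = (\<Sum>i\<le>n. mscale (\<alpha> i) (var i ^ d))"
    and \<alpha>: "\<And>i. i \<le> n \<Longrightarrow> \<alpha> i \<noteq> 0"
  shows "bij_betw (phi n d k P) (U_space n d k) (W_space n d k)"
proof -
  let ?R = "R_set n d k" and ?v = "phi_basis n d k P"
  have indep: "\<forall>u\<in>?R. q u = 0" if q: "(\<Sum>u\<in>?R. mscale (q u) (?v u)) = 0" for q
  proof (rule kernel_trivial_fract[OF ab _ _ _ finite_R_set])
    fix w assume w: "w \<in> ?R"
    have "(\<Sum>u\<in>?R. q u * lookup (?v u) w) = 0"
      using arg_cong[OF q, of "\<lambda>F. lookup F w"] by (simp add: lookup_sum)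
    then show "(\<Sum>u\<in>?R. q u * to_fract (lookup (shifted_pderiv (cofactor d u) (first_large d u) P) w)) = 0"
      using w by (simp add: lookup_phi_basis)
  next
    show "of_nat d * \<alpha> (first_large d u) \<noteq> 0" if "u \<in> ?R" for u
      using char \<alpha> R_set_decompose(1)[OF that d] by simp
  next
    show "Polynomial.degree (lookup (shifted_pderiv (cofactor d u) (first_large d u) P) w) \<le> tdegree P"
      for u w by (rule degree_lookup_shifted_pderiv)
  qed (rule heval_matrix_entry[OF d _ diag])
  show ?thesis
    unfolding bij_betw_def
  proof
    show "inj_on (phi n d k P) (U_space n d k)"
    proof (rule inj_onI)
      fix Q Q' assume "Q \<in> U_space n d k" "Q' \<in> U_space n d k" and eq: "phi n d k P Q = phi n d k P Q'"
      then obtain q q' where q: "Q = tuple_of n d k q" "Q' = tuple_of n d k q'"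
        unfolding U_space_eq_range[OF d] by blast
      have "(\<Sum>u\<in>?R. mscale (q u - q' u) (?v u)) = 0"
        using eq by (simp add: q phi_tuple_of[OF d] mpoly.scale_left_diff_distrib sum_subtractf)
      then have "\<forall>u\<in>?R. q u = q' u" using indep by fastforce
      then show "Q = Q'" by (auto simp: q tuple_of_def fun_eq_iff intro!: sum.cong)
    qed
    show "phi n d k P ` U_space n d k = W_space n d k"
    proof (intro equalityI subsetI)
      fix F assume "F \<in> phi n d k P ` U_space n d k"
      then show "F \<in> W_space n d k"
        by (auto simp: W_space_def mono_space_eq phi_def in_keys_iff lookup_proj split: if_splits)
    next
      fix F :: "(nat, 'k poly fract) mpoly"
      assume F: "F \<in> W_space n d k"
      let ?B = "(\<lambda>m. Poly_Mapping.single m (1 :: 'k poly fract)) ` ?R"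
      have "\<exists>q. F = (\<Sum>u\<in>?R. mscale (q u) (?v u))"
      proof (rule mpoly.independent_family_spans[OF finite_R_set _ _ _ indep])
        show "?v u \<in> mpoly.span ?B" for u
          unfolding mono_space_def[symmetric] mono_space_eq
          by (auto simp: in_keys_iff lookup_phi_basis split: if_splits)
        show "F \<in> mpoly.span ?B"
          using F by (simp add: W_space_def mono_space_def)
        show "finite ?B" using finite_R_set by (rule finite_imageI)
        show "card ?B \<le> card ?R" using finite_R_set by (rule card_image_le)
      qed
      then obtain q where "F = phi n d k P (tuple_of n d k q)"
        by (auto simp: phi_tuple_of[OF d])
      then show "F \<in> phi n d k P ` U_space n d k"
        unfolding U_space_eq_range[OF d] by blast
    qed
  qed
qed

lemma is_unit_in_imp_nonzero: "is_unit_in A x \<Longrightarrow> x \<noteq> 0"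
  by (auto simp: is_unit_in_def Units_def ring_on_def)

theorem theorem3p6:
  fixes p q n d k :: nat
    and nrm :: "'k::field_char_0 \<Rightarrow> real"
    and P :: "(nat, 'k poly) mpoly"
    and S :: "(coord, 'k) mpoly set set"
  assumes "unramified_extension p q nrm"
    and "d \<ge> 1"
    and "P \<in> mpolys (upolys (integer_ring nrm)) {..n}"
    and "homogeneous_of_degree {..n} d P"
    and "P1_open (integer_ring nrm) S"
    and "smooth_family (integer_ring nrm) n P S"
    and "contains_diagonal_fibre (integer_ring nrm) n d P S"
    and "k \<ge> 1"
  shows "Vector_Spaces.linear tscale mscale (phi n d k P)
    \<and> bij_betw (phi n d k P) (U_space n d k) (W_space n d k)"
proof
  obtain a b \<alpha> where point: "valued_point (integer_ring nrm) S a b"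
    and \<alpha>: "\<And>i. i \<le> n \<Longrightarrow> is_unit_in (integer_ring nrm) (\<alpha> i)"
    and diag: "fibre_eq P a b = (\<Sum>i\<le>n. mscale (\<alpha> i) (var i ^ d))"
    using assms(7) unfolding contains_diagonal_fibre_def by blast
  have "a \<noteq> 0 \<or> b \<noteq> 0"
    using point is_unit_in_imp_nonzero unfolding valued_point_def by blast
  moreover have "of_nat d \<noteq> (0 :: 'k)"
    using assms(2) by simp
  ultimately show "bij_betw (phi n d k P) (U_space n d k) (W_space n d k)"
    using phi_bij_betw[OF assms(2) _ _ diag] is_unit_in_imp_nonzero[OF \<alpha>] by blast
qed (rule linear_phi)

end
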